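(* Let $J\ge 3$. The subfamily of canonical models $\{(\text{reference},\text{logistic},Z);\ Z\in\mathfrak{Z}\}$ is equal to the subfamily of models $\{(\text{adjacent},\text{logistic},Z);\ Z\in\mathfrak{Z}\}$ (as sets of models, where equal models are identified).
   Context: Setting. Let $J\ge 3$ (number of categories), $p\ge 1$, and let $\mathcal{X}\subseteq\mathbb{R}^p$ be the nonempty set of values of the explanatory vector $x$. Let $\mathcal{M}=\{\pi\in\,]0,1[^{J-1} : \sum_{j=1}^{J-1}\pi_j<1\}$; for $\pi\in\mathcal{M}$ put $\pi_J=1-\sum_{j=1}^{J-1}\pi_j$ ($\pi_j$ is the probability of category $j$). Ratios. The reference ratio $r:\mathcal{M}\to\,]0,1[^{J-1}$ is $r_j(\pi)=\pi_j/(\pi_j+\pi_J)$; the adjacent ratio is $r_j(\pi)=\pi_j/(\pi_j+\pi_{j+1})$, for $j=1,\dots,J-1$. Each is a bijection from $\mathcal{M}$ onto $]0,1[^{J-1}$. Cdf. The logistic cdf is $F(w)=e^w/(1+e^w)$, $w\in\mathbb{R}$. Design matrices. The complete design matrix $Z_c(x)$ is the $(J-1)\times(J-1)(1+p)$ matrix with $Z_c(x)\beta=(\alpha_j+x^t\delta_j)_{j=1,\dots,J-1}$ for $\beta=(\alpha_1,\dots,\alpha_{J-1},\delta_1^t,\dots,\delta_{J-1}^t)^t$, $\alpha_j\in\mathbb{R}$, $\delta_j\in\mathbb{R}^p$. The set $\mathfrak{Z}$ of design matrices consists of all matrix functions $Z:x\mapsto Z_c(x)C$, where $C$ is a constant real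 matrix of full column rank with $q$ columns, $J-1+p\le q\le (J-1)(1+p)$. Models. A model $(r,F,Z)$, where $r$ is the reference ratio or the adjacent ratio, $F$ is the logistic cdf and $Z\in\mathfrak{Z}$ has $q$ columns, has parameter space $\mathbb{R}^q$. For $\beta\in\mathbb{R}^q$ and $x\in\mathcal{X}$, it defines the unique $\pi=\pi(x;\beta)\in\mathcal{M}$ with $r(\pi)=(F(\eta_1),\dots,F(\eta_{J-1}))^t$, where $\eta=Z(x)\beta$. Two models are equal if they have the same parameter space and give the same $\pi(x;\beta)$ for all $x\in\mathcal{X}$ and all $\beta$ in it. Two sets of models are equal if every model of each is equal to some model of the other. *)

theory Defs
  imports Complex_Main "Jordan_Normal_Form.DL_Rank"
begin

text \<open>
  Vectors and matrices are indexed from 0, so the categories are \<open>0, \<dots>, J - 1\<close> and the last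
  (reference) category is \<open>J - 1\<close>. A probability distribution is represented by the vector of its
  first \<open>J - 1\<close> probabilities.
\<close>

definition prob_space_M :: "nat \<Rightarrow> real vec set" where
  "prob_space_M J =
     {\<pi> \<in> carrier_vec (J - 1). (\<forall>j<J - 1. 0 < \<pi> $ j \<and> \<pi> $ j < 1) \<and> (\<Sum>j<J - 1. \<pi> $ j) < 1}"

definition cat_prob :: "nat \<Rightarrow> real vec \<Rightarrow> nat \<Rightarrow> real" where
  "cat_prob J \<pi> j = (if j < J - 1 then \<pi> $ j else 1 - (\<Sum>i<J - 1. \<pi> $ i))"

definition reference_ratio :: "nat \<Rightarrow> real vec \<Rightarrow> real vec" where
  "reference_ratio J \<pi> =
     vec (J - 1) (\<lambda>j. cat_prob J \<pi> j / (cat_prob J \<pi> j + cat_prob J \<pi> (J - 1)))"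

definition adjacent_ratio :: "nat \<Rightarrow> real vec \<Rightarrow> real vec" where
  "adjacent_ratio J \<pi> =
     vec (J - 1) (\<lambda>j. cat_prob J \<pi> j / (cat_prob J \<pi> j + cat_prob J \<pi> (j + 1)))"

definition logistic_cdf :: "real \<Rightarrow> real" where
  "logistic_cdf w = exp w / (1 + exp w)"

text \<open>
  The columns of the complete design matrix are ordered as
  \<open>(\<alpha>\<^sub>0, \<dots>, \<alpha>\<^bsub>J-2\<^esub>, \<delta>\<^sub>0, \<dots>, \<delta>\<^bsub>J-2\<^esub>)\<close>, each \<open>\<delta>\<^sub>i\<close> being a block of \<open>p\<close> columns; the lemma
  \<open>complete_design_mult\<close> below confirms the resulting linear predictor.
\<close>

definition complete_design :: "nat \<Rightarrow> nat \<Rightarrow> real vec \<Rightarrow> real mat" where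
  "complete_design J p x =
     mat (J - 1) ((J - 1) * (1 + p))
       (\<lambda>(i, k). if k < J - 1 then (if k = i then 1 else 0)
                 else if (k - (J - 1)) div p = i then x $ ((k - (J - 1)) mod p)
                 else 0)"

lemma complete_design_mult:
  fixes x \<beta> :: "real vec"
  assumes p: "p \<ge> 1" and x: "x \<in> carrier_vec p"
    and b: "\<beta> \<in> carrier_vec ((J - 1) * (1 + p))" and i: "i < J - 1"
  shows "(complete_design J p x *\<^sub>v \<beta>) $ i
           = \<beta> $ i + x \<bullet> vec p (\<lambda>k. \<beta> $ (J - 1 + i * p + k))"
proof -
  define n where "n = J - 1"
  define f where "f k = (if k < n then (if k = i then 1 else 0)
      else if (k - n) div p = i then x $ ((k - n) mod p) else 0) * \<beta> $ k" for k
  have i': "i < n" using i by (simp add: n_def)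
  have eq: "{k. k < n * p \<and> k div p = i} = (\<lambda>k. i * p + k) ` {..<p}"
  proof (intro equalityI subsetI)
    fix k assume "k \<in> {k. k < n * p \<and> k div p = i}"
    then have "k = i * p + k mod p" "k mod p < p" using p by auto
    then show "k \<in> (\<lambda>k. i * p + k) ` {..<p}" by blast
  next
    fix k assume "k \<in> (\<lambda>k. i * p + k) ` {..<p}"
    then obtain l where l: "k = i * p + l" "l < p" by auto
    have "k < Suc i * p" using l by simp
    also have "\<dots> \<le> n * p" using i' by (intro mult_right_mono) auto
    finally show "k \<in> {k. k < n * p \<and> k div p = i}" using l by simp
  qed
  have "(complete_design J p x *\<^sub>v \<beta>) $ i = (\<Sum>k<n + n * p. f k)"
    using b i' unfolding complete_design_def f_def n_def
    by (simp add: scalar_prod_def atLeast0LessThan)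
  also have "\<dots> = (\<Sum>k<n. f k) + (\<Sum>k<n * p. f (n + k))"
  proof -
    have "(\<Sum>k<n + m. f k) = (\<Sum>k<n. f k) + (\<Sum>k<m. f (n + k))" for m
      by (induction m) (simp_all add: add.assoc)
    then show ?thesis .
  qed
  also have "(\<Sum>k<n. f k) = \<beta> $ i"
  proof -
    have "(\<Sum>k<n. f k) = (\<Sum>k<n. if k = i then \<beta> $ k else 0)"
      by (intro sum.cong) (auto simp: f_def)
    then show ?thesis using i' by simp
  qed
  also have "(\<Sum>k<n * p. f (n + k))
      = (\<Sum>k | k < n * p \<and> k div p = i. x $ (k mod p) * \<beta> $ (n + k))"
    by (intro sum.mono_neutral_cong_right) (auto simp: f_def)
  also have "\<dots> = (\<Sum>k<p. x $ k * \<beta> $ (n + i * p + k))"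
    unfolding eq by (subst sum.reindex) (auto simp: inj_on_def add.assoc)
  finally show ?thesis by (simp add: scalar_prod_def atLeast0LessThan n_def)
qed

definition design_matrices :: "nat \<Rightarrow> nat \<Rightarrow> (real vec \<Rightarrow> real mat) set" where
  "design_matrices J p =
     {\<lambda>x. complete_design J p x * C | C q.
        C \<in> carrier_mat ((J - 1) * (1 + p)) q \<and>
        vec_space.rank ((J - 1) * (1 + p)) C = q \<and>
        J - 1 + p \<le> q \<and> q \<le> (J - 1) * (1 + p)}"

type_synonym model = "(real vec \<Rightarrow> real vec) \<times> (real \<Rightarrow> real) \<times> (real vec \<Rightarrow> real mat)"

text \<open>
  For a design \<open>Z\<close> with \<open>q\<close> columns and nonempty \<open>X\<close>, \<open>param_space X (r, F, Z)\<close> is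
  \<open>carrier_vec q\<close>.
\<close>

definition param_space :: "real vec set \<Rightarrow> model \<Rightarrow> real vec set" where
  "param_space X = (\<lambda>(r, F, Z). {\<beta>. \<forall>x\<in>X. \<beta> \<in> carrier_vec (dim_col (Z x))})"

definition model_prob :: "nat \<Rightarrow> model \<Rightarrow> real vec \<Rightarrow> real vec \<Rightarrow> real vec" where
  "model_prob J = (\<lambda>(r, F, Z) x \<beta>. THE \<pi>. \<pi> \<in> prob_space_M J \<and> r \<pi> = map_vec F (Z x *\<^sub>v \<beta>))"

definition models_equal :: "nat \<Rightarrow> real vec set \<Rightarrow> model \<Rightarrow> model \<Rightarrow> bool" where
  "models_equal J X m m' \<longleftrightarrow>
     param_space X m = param_space X m' \<and>
     (\<forall>x\<in>X. \<forall>\<beta>\<in>param_space X m. model_prob J m x \<beta> = model_prob J m' x \<beta>)"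

definition model_sets_equal :: "nat \<Rightarrow> real vec set \<Rightarrow> model set \<Rightarrow> model set \<Rightarrow> bool" where
  "model_sets_equal J X A B \<longleftrightarrow>
     (\<forall>m\<in>A. \<exists>m'\<in>B. models_equal J X m m') \<and> (\<forall>m'\<in>B. \<exists>m\<in>A. models_equal J X m' m)"

end

theory Submission
  imports Defs
begin

text \<open>
  Put \<open>\<eta>\<^bsub>J-1\<^esub> = 0\<close>. With the logistic cdf, the reference model says
  \<open>\<pi>\<^sub>j = exp \<eta>\<^sub>j * \<pi>\<^bsub>J-1\<^esub>\<close> for all \<open>j\<close>, which is equivalent to
  \<open>\<pi>\<^sub>j = exp (\<eta>\<^sub>j - \<eta>\<^bsub>j+1\<^esub>) * \<pi>\<^bsub>j+1\<^esub>\<close> for all \<open>j\<close>, i.e. to the adjacent model with predictor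
  \<open>A \<eta>\<close> for an invertible bidiagonal matrix \<open>A\<close>. Since \<open>A Z\<^sub>c(x) = Z\<^sub>c(x) D\<close>, where \<open>D\<close> is the
  invertible matrix that applies \<open>A\<close> to the intercepts and to each coordinate of the slopes,
  passing from \<open>Z\<close> to \<open>A Z\<close> or \<open>A\<^sup>-\<^sup>1 Z\<close> does not leave the set of design matrices.
\<close>

section \<open>Full column rank\<close>

text \<open>The rank is the size of a maximal independent subset of the set of columns, and a
  repeated column would leave that set with fewer than \<open>nc\<close> elements.\<close>

lemma (in vec_space) full_rank_distinct_cols:
  assumes A: "A \<in> carrier_mat n nc" and "rank A = nc"
  shows "distinct (cols A)"
proof (rule ccontr)
  assume "\<not> distinct (cols A)"
  then have less: "card (set (cols A)) < nc"
    using A by (metis cols_length carrier_matD(2) card_distinct card_length le_neq_implies_less)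
  obtain S where S: "maximal S (\<lambda>T. T \<subseteq> set (cols A) \<and> lin_indpt T)"
    using maximal_exists[of "(\<lambda>T. T \<subseteq> set (cols A) \<and> lin_indpt T)" "card (set (cols A))" "{}"]
    by (meson List.finite_set card_mono empty_iff empty_subsetI finite_lin_indpt2 rev_finite_subset)
  then have "card S \<le> card (set (cols A))"
    by (simp add: card_mono maximal_def)
  then show False
    using rank_card_indpt[OF A S] assms(2) less by simp
qed

text \<open>A left inverse \<open>L\<close> makes \<open>D\<close> injective, so a kernel vector of
  \<open>D * A\<close> is already one of \<open>A\<close>.\<close>

lemma (in vec_space) full_rank_left_invertible_mult:
  assumes A: "A \<in> carrier_mat n nc" and r: "rank A = nc"
    and D: "D \<in> carrier_mat n n" and L: "L \<in> carrier_mat n n" and LD: "L * D = 1\<^sub>m n"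
  shows "rank (D * A) = nc"
proof -
  have DA: "D * A \<in> carrier_mat n nc"
    using D A by simp
  have cancel: "L *\<^sub>v (D *\<^sub>v v) = v" if "v \<in> carrier_vec n" for v
    using assoc_mult_mat_vec[OF L D that] LD that by simp
  have dist: "distinct (cols A)"
    by (rule full_rank_distinct_cols[OF A r])
  \<comment> \<open>Dependence concerns the set of columns, so distinctness is what lets it be
    expressed by nonzero kernel vectors.\<close>
  have dist': "distinct (cols (D * A))"
  proof -
    have "cols A ! i = cols A ! j"
      if ij: "i < nc" "j < nc" and eq: "cols (D * A) ! i = cols (D * A) ! j" for i j
    proof -
      have "D *\<^sub>v col A i = D *\<^sub>v col A j"
        using eq ij DA A by (simp add: cols_nth col_mult2[OF D A] del: col_mult2)
      then have "col A i = col A j"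
        using cancel A ij by (metis carrier_matD(1) col_dim)
      then show ?thesis using ij A by simp
    qed
    then show ?thesis
      using dist A D by (auto simp: distinct_conv_nth)
  qed
  have "lin_indpt (set (cols (D * A)))"
  proof
    assume "lin_dep (set (cols (D * A)))"
    then obtain v where v: "v \<in> carrier_vec nc" "v \<noteq> 0\<^sub>v nc" "(D * A) *\<^sub>v v = 0\<^sub>v n"
      using lin_depE[OF DA _ dist'] by blast
    have "D *\<^sub>v (A *\<^sub>v v) = 0\<^sub>v n"
      using v D A by (simp add: assoc_mult_mat_vec)
    then have "A *\<^sub>v v = L *\<^sub>v 0\<^sub>v n"
      using cancel[of "A *\<^sub>v v"] A v by simp
    then have "A *\<^sub>v v = 0\<^sub>v n"
      using L by auto
    then have "lin_dep (set (cols A))"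
      using lin_depI[OF A v(1,2)] dist by blast
    then show False
      using full_rank_lin_indpt[OF A r dist] by blast
  qed
  then show ?thesis
    by (rule lin_indpt_full_rank[OF DA dist'])
qed

section \<open>Lifting matrices through the complete design\<close>

text \<open>
  Coordinate \<open>k\<close> of \<open>\<beta>\<close> belongs to the category \<open>coord_cat n p k\<close>; it is the intercept of that
  category if \<open>coord_kind n p k = 0\<close>, and component \<open>l\<close> of its slope if \<open>coord_kind n p k = Suc l\<close>.
\<close>

definition coord_cat :: "nat \<Rightarrow> nat \<Rightarrow> nat \<Rightarrow> nat" where
  "coord_cat n p k = (if k < n then k else (k - n) div p)"

definition coord_kind :: "nat \<Rightarrow> nat \<Rightarrow> nat \<Rightarrow> nat" where
  "coord_kind n p k = (if k < n then 0 else Suc ((k - n) mod p))"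

text \<open>Inverse of the pairing of \<open>coord_cat\<close> and
  \<open>coord_kind\<close>.\<close>

definition coord_of :: "nat \<Rightarrow> nat \<Rightarrow> nat \<Rightarrow> nat \<Rightarrow> nat" where
  "coord_of n p i l = (if l = 0 then i else n + i * p + (l - 1))"

lemma coord_of_cat_kind: "coord_of n p (coord_cat n p k) (coord_kind n p k) = k"
  by (simp add: coord_of_def coord_cat_def coord_kind_def)

lemma coord_cat_less: "k < n * (1 + p) \<Longrightarrow> coord_cat n p k < n"
  by (auto simp: coord_cat_def intro!: less_mult_imp_div_less)

lemma coord_kind_less: "p \<ge> 1 \<Longrightarrow> coord_kind n p k < 1 + p"
  by (simp add: coord_kind_def)

lemma coord_cat_of: "i < n \<Longrightarrow> l < 1 + p \<Longrightarrow> coord_cat n p (coord_of n p i l) = i"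
  by (cases l) (auto simp: coord_cat_def coord_of_def)

lemma coord_kind_of: "i < n \<Longrightarrow> l < 1 + p \<Longrightarrow> coord_kind n p (coord_of n p i l) = l"
  by (cases l) (auto simp: coord_kind_def coord_of_def)

lemma coord_of_less:
  assumes "i < n" "l < 1 + p"
  shows "coord_of n p i l < n * (1 + p)"
proof (cases l)
  case 0
  then show ?thesis using assms by (simp add: coord_of_def)
next
  case (Suc m)
  have "i * p + m < Suc i * p" using assms Suc by simp
  also have "\<dots> \<le> n * p" using assms by (intro mult_right_mono) auto
  finally show ?thesis using Suc by (simp add: coord_of_def)
qed

text \<open>Coordinates correspond bijectively to pairs of category and kind. The double sum makes
  it possible to collapse the conditions on the kind below.\<close>

lemma sum_coords:
  fixes g :: "nat \<Rightarrow> nat \<Rightarrow> 'a :: comm_monoid_add"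
  assumes "p \<ge> 1"
  shows "(\<Sum>k<n * (1 + p). g (coord_cat n p k) (coord_kind n p k)) = (\<Sum>i<n. \<Sum>l<1 + p. g i l)"
  unfolding sum.cartesian_product
  by (rule sum.reindex_bij_witness[where i = "\<lambda>(i, l). coord_of n p i l"
        and j = "\<lambda>k. (coord_cat n p k, coord_kind n p k)"])
    (use assms in \<open>auto simp: coord_of_cat_kind coord_cat_less coord_kind_less
       coord_cat_of coord_kind_of coord_of_less simp del: mult_Suc_right plus_1_eq_Suc One_nat_def\<close>)

text \<open>Up to the order of the coordinates, this is the Kronecker product of \<open>M\<close>
  with the identity of size \<open>1 + p\<close>.\<close>

definition lift_mat :: "nat \<Rightarrow> nat \<Rightarrow> real mat \<Rightarrow> real mat" where
  "lift_mat n p M = mat (n * (1 + p)) (n * (1 + p))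
     (\<lambda>(r, c). if coord_kind n p r = coord_kind n p c
               then M $$ (coord_cat n p r, coord_cat n p c) else 0)"

lemma lift_mat_carrier: "lift_mat n p M \<in> carrier_mat (n * (1 + p)) (n * (1 + p))"
  by (simp add: lift_mat_def)

lemma lift_mat_one: "lift_mat n p (1\<^sub>m n) = 1\<^sub>m (n * (1 + p))"
proof (rule eq_matI)
  fix r c assume "r < dim_row (1\<^sub>m (n * (1 + p)) :: real mat)" "c < dim_col (1\<^sub>m (n * (1 + p)) :: real mat)"
  then have rc: "r < n * (1 + p)" "c < n * (1 + p)" by auto
  have "r = c" if "coord_kind n p r = coord_kind n p c" "coord_cat n p r = coord_cat n p c"
    using that coord_of_cat_kind by metis
  then show "lift_mat n p (1\<^sub>m n) $$ (r, c) = 1\<^sub>m (n * (1 + p)) $$ (r, c)"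
    using rc coord_cat_less[of r n p] coord_cat_less[of c n p]
    by (auto simp: lift_mat_def simp del: mult_Suc_right)
qed (simp_all add: lift_mat_def)

text \<open>The product rule of Kronecker products with an identity factor; with
  \<open>lift_mat_one\<close> it carries inverses of \<open>M\<close> over to its lift.\<close>

lemma lift_mat_mult:
  assumes p: "p \<ge> 1" and M: "M \<in> carrier_mat n n" and N: "N \<in> carrier_mat n n"
  shows "lift_mat n p M * lift_mat n p N = lift_mat n p (M * N)"
proof (rule eq_matI)
  fix r c assume "r < dim_row (lift_mat n p (M * N))" "c < dim_col (lift_mat n p (M * N))"
  then have rc: "r < n * (1 + p)" "c < n * (1 + p)" by (simp_all add: lift_mat_def)
  let ?cat = "coord_cat n p" and ?kind = "coord_kind n p"
  have "(lift_mat n p M * lift_mat n p N) $$ (r, c) =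
      (\<Sum>k<n * (1 + p). (if ?kind r = ?kind k then M $$ (?cat r, ?cat k) else 0) *
         (if ?kind k = ?kind c then N $$ (?cat k, ?cat c) else 0))"
    using rc by (simp add: lift_mat_def scalar_prod_def atLeast0LessThan del: mult_Suc_right)
  also have "\<dots> = (\<Sum>i<n. \<Sum>l<1 + p. (if ?kind r = l then M $$ (?cat r, i) else 0) *
         (if l = ?kind c then N $$ (i, ?cat c) else 0))"
    by (rule sum_coords[OF p])
  also have "\<dots> = (\<Sum>i<n. if ?kind r = ?kind c then M $$ (?cat r, i) * N $$ (i, ?cat c) else 0)"
  \<comment> \<open>For fixed \<open>i\<close>, only the kind \<open>l = ?kind c\<close> can
    contribute to the inner sum.\<close>
  proof (rule sum.cong[OF refl])
    fix i
    have "(\<Sum>l<1 + p. (if ?kind r = l then M $$ (?cat r, i) else 0) *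
         (if l = ?kind c then N $$ (i, ?cat c) else 0)) =
       (\<Sum>l<1 + p. if l = ?kind c then
         (if ?kind r = ?kind c then M $$ (?cat r, i) * N $$ (i, ?cat c) else 0) else 0)"
      by (intro sum.cong) auto
    also have "\<dots> = (if ?kind r = ?kind c then M $$ (?cat r, i) * N $$ (i, ?cat c) else 0)"
      using coord_kind_less[OF p, of n c] by (subst sum.delta) auto
    finally show "(\<Sum>l<1 + p. (if ?kind r = l then M $$ (?cat r, i) else 0) *
         (if l = ?kind c then N $$ (i, ?cat c) else 0)) =
       (if ?kind r = ?kind c then M $$ (?cat r, i) * N $$ (i, ?cat c) else 0)" .
  qed
  also have "\<dots> = lift_mat n p (M * N) $$ (r, c)"
    using rc M N coord_cat_less[of r n p] coord_cat_less[of c n p]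
    by (simp add: lift_mat_def scalar_prod_def atLeast0LessThan del: mult_Suc_right)
  finally show "(lift_mat n p M * lift_mat n p N) $$ (r, c) = lift_mat n p (M * N) $$ (r, c)" .
qed (simp_all add: lift_mat_def)

text \<open>The complete design is the Kronecker product of the identity with the row
  \<open>(1, x)\<close>, while the lift acts on the category factor only. Both sides have entry
  \<open>M $$ (i, ?cat c) * y (?kind c)\<close> at \<open>(i, c)\<close>.\<close>

lemma complete_design_lift_mat:
  assumes p: "p \<ge> 1" and M: "M \<in> carrier_mat (J - 1) (J - 1)"
  shows "complete_design J p x * lift_mat (J - 1) p M = M * complete_design J p x"
proof -
  define n where "n = J - 1"
  \<comment> \<open>\<open>y\<close> is \<open>x\<close> with a leading 1 for the intercept, hence
    the index shift.\<close>
  define y where "y l = (if l = 0 then 1 else x $ (l - 1))" for l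
  let ?cat = "coord_cat n p" and ?kind = "coord_kind n p"
  have Z: "complete_design J p x = mat n (n * (1 + p)) (\<lambda>(i, k). if ?cat k = i then y (?kind k) else 0)"
    unfolding complete_design_def n_def[symmetric]
    by (rule cong_mat) (auto simp: coord_cat_def coord_kind_def y_def)
  have "complete_design J p x * lift_mat n p M = M * complete_design J p x"
  proof (rule eq_matI)
    fix i c assume "i < dim_row (M * complete_design J p x)" "c < dim_col (M * complete_design J p x)"
    then have ic: "i < n" "c < n * (1 + p)" using M by (simp_all add: Z n_def)
    have "(complete_design J p x * lift_mat n p M) $$ (i, c) =
        (\<Sum>k<n * (1 + p). (if ?cat k = i then y (?kind k) else 0) *
           (if ?kind k = ?kind c then M $$ (?cat k, ?cat c) else 0))"
      using ic by (simp add: Z lift_mat_def scalar_prod_def atLeast0LessThan del: mult_Suc_right)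
    also have "\<dots> = (\<Sum>j<n. \<Sum>l<1 + p. (if j = i then y l else 0) *
           (if l = ?kind c then M $$ (j, ?cat c) else 0))"
      by (rule sum_coords[OF p])
    also have "\<dots> = (\<Sum>j<n. if j = i then M $$ (i, ?cat c) * y (?kind c) else 0)"
    proof (rule sum.cong[OF refl])
      fix j
      have "(\<Sum>l<1 + p. (if j = i then y l else 0) * (if l = ?kind c then M $$ (j, ?cat c) else 0)) =
         (\<Sum>l<1 + p. if l = ?kind c then (if j = i then M $$ (i, ?cat c) * y (?kind c) else 0) else 0)"
        by (intro sum.cong) auto
      also have "\<dots> = (if j = i then M $$ (i, ?cat c) * y (?kind c) else 0)"
        using coord_kind_less[OF p, of n c] by (subst sum.delta) auto
      finally show "(\<Sum>l<1 + p. (if j = i then y l else 0) *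
           (if l = ?kind c then M $$ (j, ?cat c) else 0)) =
         (if j = i then M $$ (i, ?cat c) * y (?kind c) else 0)" .
    qed
    also have "\<dots> = M $$ (i, ?cat c) * y (?kind c)"
      using ic by simp
    also have "\<dots> = (\<Sum>j<n. M $$ (i, j) * (if ?cat c = j then y (?kind c) else 0))"
      using coord_cat_less[OF ic(2)]
      by (simp add: if_distrib[of "\<lambda>t. _ * t"] cong: if_cong)
    also have "\<dots> = (M * complete_design J p x) $$ (i, c)"
      using ic M by (simp add: Z n_def scalar_prod_def atLeast0LessThan del: mult_Suc_right)
    finally show "(complete_design J p x * lift_mat n p M) $$ (i, c) =
        (M * complete_design J p x) $$ (i, c)" .
  qed (use M in \<open>simp_all add: Z lift_mat_def n_def\<close>)
  then show ?thesis by (simp add: n_def)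
qed

section \<open>Closure of the design matrices under invertible left factors\<close>

lemma complete_design_carrier:
  "complete_design J p x \<in> carrier_mat (J - 1) ((J - 1) * (1 + p))"
  by (simp add: complete_design_def)

text \<open>The factor \<open>M\<close> moves through the complete design and turns \<open>C\<close>
  into \<open>?D * C\<close>; the lift of \<open>N\<close> is a left inverse of \<open>?D\<close>,
  so the column rank stays \<open>q\<close>.\<close>

lemma design_matrices_mult_left:
  assumes p: "p \<ge> 1" and Z: "Z \<in> design_matrices J p"
    and M: "M \<in> carrier_mat (J - 1) (J - 1)" and N: "N \<in> carrier_mat (J - 1) (J - 1)"
    and NM: "N * M = 1\<^sub>m (J - 1)"
  shows "(\<lambda>x. M * Z x) \<in> design_matrices J p"
proof -
  let ?m = "(J - 1) * (1 + p)" and ?D = "lift_mat (J - 1) p M"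
  interpret vec_space "TYPE(real)" ?m .
  obtain C q where ZC: "Z = (\<lambda>x. complete_design J p x * C)"
    and C: "C \<in> carrier_mat ?m q" "rank C = q" and q: "J - 1 + p \<le> q" "q \<le> ?m"
    using Z unfolding design_matrices_def by blast
  have "M * Z x = complete_design J p x * (?D * C)" for x
    using assoc_mult_mat[OF complete_design_carrier lift_mat_carrier C(1), of x M]
      assoc_mult_mat[OF M complete_design_carrier C(1), of x]
      complete_design_lift_mat[OF p M, of x]
    by (simp add: ZC)
  moreover have "lift_mat (J - 1) p N * ?D = 1\<^sub>m ?m"
    unfolding lift_mat_mult[OF p N M] NM by (rule lift_mat_one)
  then have "rank (?D * C) = q"
    by (rule full_rank_left_invertible_mult[OF C lift_mat_carrier lift_mat_carrier])
  moreover have "?D * C \<in> carrier_mat ?m q"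
    using lift_mat_carrier C(1) by (rule mult_carrier_mat)
  ultimately show ?thesis
    unfolding design_matrices_def using q by blast
qed

section \<open>From reference to adjacent ratios\<close>

lemma cat_prob_pos:
  assumes "\<pi> \<in> prob_space_M J"
  shows "cat_prob J \<pi> j > 0"
  using assms by (auto simp: prob_space_M_def cat_prob_def)

text \<open>Cross-multiplying gives \<open>a * (1 + exp w) = exp w * (a + b)\<close>, where the
  terms \<open>a * exp w\<close> cancel. Both ratio equations thereby become log-linear.\<close>

lemma ratio_eq_logistic_iff:
  fixes a b :: real
  assumes "a > 0" "b > 0"
  shows "a / (a + b) = logistic_cdf w \<longleftrightarrow> a = exp w * b"
proof -
  have "1 + exp w > 0" by (simp add: add_pos_pos)
  then show ?thesis
    using assms by (simp add: logistic_cdf_def frac_eq_eq distrib_left distrib_right mult.commute)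
qed

lemma reference_ratio_eq_iff:
  assumes "\<pi> \<in> prob_space_M J" and "\<eta> \<in> carrier_vec (J - 1)"
  shows "reference_ratio J \<pi> = map_vec logistic_cdf \<eta> \<longleftrightarrow>
    (\<forall>j<J - 1. cat_prob J \<pi> j = exp (\<eta> $ j) * cat_prob J \<pi> (J - 1))"
  using assms by (auto simp: reference_ratio_def vec_eq_iff ratio_eq_logistic_iff cat_prob_pos)

lemma adjacent_ratio_eq_iff:
  assumes "\<pi> \<in> prob_space_M J" and "\<eta> \<in> carrier_vec (J - 1)"
  shows "adjacent_ratio J \<pi> = map_vec logistic_cdf \<eta> \<longleftrightarrow>
    (\<forall>j<J - 1. cat_prob J \<pi> j = exp (\<eta> $ j) * cat_prob J \<pi> (j + 1))"
  using assms by (auto simp: adjacent_ratio_def vec_eq_iff ratio_eq_logistic_iff cat_prob_pos)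

text \<open>Dividing consecutive equations on the left gives the right side; conversely, the factors
  on the right telescope up to index \<open>n\<close>.\<close>

lemma ratio_last_iff_ratio_next:
  fixes P e :: "nat \<Rightarrow> real"
  assumes "e n = 0"
  shows "(\<forall>j<n. P j = exp (e j) * P n) \<longleftrightarrow> (\<forall>j<n. P j = exp (e j - e (Suc j)) * P (Suc j))"
proof
  assume L: "\<forall>j<n. P j = exp (e j) * P n"
  show "\<forall>j<n. P j = exp (e j - e (Suc j)) * P (Suc j)"
  proof (intro allI impI)
    fix j assume "j < n"
    \<comment> \<open>When \<open>Suc j = n\<close>, the second equation is no instance of
      \<open>L\<close>; it follows from \<open>e n = 0\<close>.\<close>
    then have "P j = exp (e j) * P n" "P (Suc j) = exp (e (Suc j)) * P n"
      using L assms by (blast, cases "Suc j = n") (use L in auto)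
    then show "P j = exp (e j - e (Suc j)) * P (Suc j)"
      by (simp add: exp_diff)
  qed
next
  assume R: "\<forall>j<n. P j = exp (e j - e (Suc j)) * P (Suc j)"
  have "P j = exp (e j) * P n" if "j \<le> n" for j
    using that
  \<comment> \<open>The induction runs downward from \<open>n\<close>, since each equation of
    \<open>R\<close> expresses \<open>P j\<close> through \<open>P (Suc j)\<close>.\<close>
  proof (induction j rule: inc_induct)
    case base
    then show ?case using assms by simp
  next
    case (step j)
    then have "P j = exp (e j - e (Suc j)) * (exp (e (Suc j)) * P n)"
      using R by metis
    then show ?case by (simp add: exp_diff)
  qed
  then show "\<forall>j<n. P j = exp (e j) * P n" using less_imp_le by blast
qed

section \<open>The difference matrix and its inverse\<close>

text \<open>Takes successive differences of a vector continued by 0; hence the last row contains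
  only its diagonal 1.\<close>

definition diff_mat :: "nat \<Rightarrow> real mat" where
  "diff_mat n = mat n n (\<lambda>(i, j). if j = i then 1 else if j = Suc i then - 1 else 0)"

definition tail_sum_mat :: "nat \<Rightarrow> real mat" where
  "tail_sum_mat n = mat n n (\<lambda>(i, j). if i \<le> j then 1 else 0)"

lemma diff_mat_carrier: "diff_mat n \<in> carrier_mat n n"
  by (simp add: diff_mat_def)

lemma tail_sum_mat_carrier: "tail_sum_mat n \<in> carrier_mat n n"
  by (simp add: tail_sum_mat_def)

lemma diff_mat_mult_vec:
  assumes "v \<in> carrier_vec n" and "i < n"
  shows "(diff_mat n *\<^sub>v v) $ i = v $ i - (if Suc i < n then v $ Suc i else 0)"
proof -
  have "(diff_mat n *\<^sub>v v) $ i =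
      (\<Sum>k<n. (if k = i then v $ k else 0) - (if k = Suc i then v $ k else 0))"
    using assms by (auto simp: diff_mat_def scalar_prod_def atLeast0LessThan intro!: sum.cong)
  then show ?thesis using assms(2) by (simp add: sum_subtractf)
qed

text \<open>Column \<open>j\<close> of \<open>tail_sum_mat n\<close> is 1 up to index
  \<open>j\<close> and 0 afterwards, so its only nonzero successive difference is the 1 at
  \<open>j\<close>.\<close>

lemma diff_mat_tail_sum_mat: "diff_mat n * tail_sum_mat n = 1\<^sub>m n"
proof (rule eq_matI)
  fix i j assume "i < dim_row (1\<^sub>m n :: real mat)" "j < dim_col (1\<^sub>m n :: real mat)"
  then have ij: "i < n" "j < n" by auto
  have "(diff_mat n * tail_sum_mat n) $$ (i, j) = (diff_mat n *\<^sub>v col (tail_sum_mat n) j) $ i"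
    using ij by (simp add: diff_mat_def tail_sum_mat_def)
  also have "\<dots> = 1\<^sub>m n $$ (i, j)"
    using ij by (subst diff_mat_mult_vec) (auto simp: tail_sum_mat_def)
  finally show "(diff_mat n * tail_sum_mat n) $$ (i, j) = 1\<^sub>m n $$ (i, j)" .
qed (simp_all add: diff_mat_def tail_sum_mat_def)

lemma tail_sum_mat_diff_mat: "tail_sum_mat n * diff_mat n = 1\<^sub>m n"
  by (rule mat_mult_left_right_inverse[OF diff_mat_carrier tail_sum_mat_carrier
        diff_mat_tail_sum_mat])

lemma reference_iff_adjacent:
  assumes \<pi>: "\<pi> \<in> prob_space_M J" and \<eta>: "\<eta> \<in> carrier_vec (J - 1)"
  shows "reference_ratio J \<pi> = map_vec logistic_cdf \<eta> \<longleftrightarrow>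
    adjacent_ratio J \<pi> = map_vec logistic_cdf (diff_mat (J - 1) *\<^sub>v \<eta>)"
proof -
  \<comment> \<open>The default 0 is the predictor of the reference category \<open>J - 1\<close>;
    it matches the truncated last row of \<open>diff_mat\<close>.\<close>
  define e where "e j = (if j < J - 1 then \<eta> $ j else 0)" for j
  have "reference_ratio J \<pi> = map_vec logistic_cdf \<eta> \<longleftrightarrow>
      (\<forall>j<J - 1. cat_prob J \<pi> j = exp (e j) * cat_prob J \<pi> (J - 1))"
    unfolding reference_ratio_eq_iff[OF \<pi> \<eta>] by (auto simp: e_def)
  also have "\<dots> \<longleftrightarrow>
      (\<forall>j<J - 1. cat_prob J \<pi> j = exp (e j - e (Suc j)) * cat_prob J \<pi> (Suc j))"
    by (rule ratio_last_iff_ratio_next) (simp add: e_def)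
  also have "\<dots> \<longleftrightarrow> adjacent_ratio J \<pi> = map_vec logistic_cdf (diff_mat (J - 1) *\<^sub>v \<eta>)"
    unfolding adjacent_ratio_eq_iff[OF \<pi> mult_mat_vec_carrier[OF diff_mat_carrier \<eta>]]
    by (intro all_cong) (simp add: diff_mat_mult_vec[OF \<eta>] e_def Suc_eq_plus1 del: One_nat_def add_Suc_right)
  finally show ?thesis .
qed

section \<open>Equality of models\<close>

lemma models_equal_sym: "models_equal J X m m' \<Longrightarrow> models_equal J X m' m"
  by (auto simp: models_equal_def)

text \<open>The definite descriptions in \<open>model_prob\<close> have equivalent predicates. A
  left factor preserves the number of columns, hence the parameter space.\<close>

lemma models_equal_reference_adjacent:
  assumes "\<And>x. Z x \<in> carrier_mat (J - 1) q"
  shows "models_equal J X (reference_ratio J, logistic_cdf, Z)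
    (adjacent_ratio J, logistic_cdf, \<lambda>x. diff_mat (J - 1) * Z x)"
proof -
  have "model_prob J (reference_ratio J, logistic_cdf, Z) x \<beta> =
      model_prob J (adjacent_ratio J, logistic_cdf, \<lambda>x. diff_mat (J - 1) * Z x) x \<beta>"
    if \<beta>: "\<beta> \<in> carrier_vec (dim_col (Z x))" for x \<beta>
  proof -
    have b: "\<beta> \<in> carrier_vec q" using \<beta> assms[of x] by simp
    show ?thesis
      unfolding model_prob_def prod.case
        assoc_mult_mat_vec[OF diff_mat_carrier assms b]
      \<comment> \<open>\<open>conj_cong\<close> supplies membership in
        \<open>prob_space_M J\<close> while the two ratio equations are compared.\<close>
      by (rule arg_cong[where f = The], rule ext, rule conj_cong[OF refl])
        (rule reference_iff_adjacent[OF _ mult_mat_vec_carrier[OF assms b]])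
  qed
  then show ?thesis
    by (auto simp: models_equal_def param_space_def)
qed

lemma design_matrices_carrier:
  assumes "Z \<in> design_matrices J p"
  obtains q where "\<And>x. Z x \<in> carrier_mat (J - 1) q"
  using assms mult_carrier_mat[OF complete_design_carrier]
  unfolding design_matrices_def by blast

theorem corollary2:
  fixes J p :: nat and X :: "real vec set"
  assumes "J \<ge> 3" and "p \<ge> 1"
    and "X \<subseteq> carrier_vec p" and "X \<noteq> {}"
  shows "model_sets_equal J X
           {(reference_ratio J, logistic_cdf, Z) | Z. Z \<in> design_matrices J p}
           {(adjacent_ratio J, logistic_cdf, Z) | Z. Z \<in> design_matrices J p}"
proof -
  let ?A = "diff_mat (J - 1)" and ?S = "tail_sum_mat (J - 1)"
  have ref: "\<exists>Z'\<in>design_matrices J p.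
      models_equal J X (reference_ratio J, logistic_cdf, Z) (adjacent_ratio J, logistic_cdf, Z')"
    if Z: "Z \<in> design_matrices J p" for Z
  proof -
    obtain q where "\<And>x. Z x \<in> carrier_mat (J - 1) q"
      using design_matrices_carrier[OF Z] by blast
    \<comment> \<open>The witness is the design with values \<open>?A * Z x\<close>, with
      \<open>?S\<close> as the left inverse of \<open>?A\<close>.\<close>
    then show ?thesis
      using models_equal_reference_adjacent
        design_matrices_mult_left[OF \<open>p \<ge> 1\<close> Z diff_mat_carrier tail_sum_mat_carrier
          tail_sum_mat_diff_mat] by blast
  qed
  have adj: "\<exists>Z'\<in>design_matrices J p.
      models_equal J X (adjacent_ratio J, logistic_cdf, Z) (reference_ratio J, logistic_cdf, Z')"
    if Z: "Z \<in> design_matrices J p" for Z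
  proof -
    obtain q where q: "\<And>x. Z x \<in> carrier_mat (J - 1) q"
      using design_matrices_carrier[OF Z] by blast
    \<comment> \<open>The witness is the design with values \<open>?S * Z x\<close>: its adjacent
      counterpart has values \<open>?A * (?S * Z x)\<close>, which is \<open>Z x\<close>
      again.\<close>
    have "?S * Z x \<in> carrier_mat (J - 1) q" for x
      using tail_sum_mat_carrier q by (rule mult_carrier_mat)
    then have "models_equal J X (reference_ratio J, logistic_cdf, \<lambda>x. ?S * Z x)
        (adjacent_ratio J, logistic_cdf, \<lambda>x. ?A * (?S * Z x))"
      by (rule models_equal_reference_adjacent)
    also have "(\<lambda>x. ?A * (?S * Z x)) = Z"
    proof
      fix x
      show "?A * (?S * Z x) = Z x"
        using assoc_mult_mat[OF diff_mat_carrier tail_sum_mat_carrier q[of x]] q[of x]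
        by (simp add: diff_mat_tail_sum_mat)
    qed
    finally show ?thesis
      using models_equal_sym
        design_matrices_mult_left[OF \<open>p \<ge> 1\<close> Z tail_sum_mat_carrier diff_mat_carrier
          diff_mat_tail_sum_mat] by blast
  qed
  show ?thesis
    unfolding model_sets_equal_def using ref adj by blast
qed

end
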